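(* Let $G=(V,E)$ be a finite simple graph, and let $f$ be random, distributed according to the probability space $(\Omega,\mathrm{P})$ of injective functions $f:V\to[-1,1]$ (described in the context; the values $f(v)$, $v\in V$, are independent and uniformly distributed on $[-1,1]$). Then for every vertex $x\in V$, the expectation of the index $i_f(x)$ equals the curvature $K(x)$: $$\mathrm{E}[i_f(x)] = K(x).$$
   Context: Let $G=(V,E)$ be a finite simple graph with $n=|V|$ vertices. $K_m$ denotes the complete graph on $m$ vertices; "number of $K_{m}$ subgraphs" means the number of $m$-element vertex sets that are pairwise adjacent (cliques of size $m$). Euler characteristic: for a finite simple graph $H$, $\chi(H)=\sum_{k=0}^{\infty}(-1)^k v_k(H)$, where $v_k(H)$ is the number of $K_{k+1}$ subgraphs of $H$ (so the empty graph has Euler characteristic $0$). Unit sphere: for $x\in V$, $S(x)$ is the subgraph of $G$ generated (induced) by the vertices adjacent to $x$. Curvature: $K(x)=\sum_{k=0}^{\infty}(-1)^k\frac{V_{k-1}(x)}{k+1}$, where for $k\ge 0$, $V_k(x)$ is the number of $K_{k+1}$ subgraphs of $S(x)$, and $V_{-1}(x)=1$. Index: for an injective function $f:V\to\mathbb{R}$, the exit set $S^-(x)$ is the subgraph of $S(x)$ generated (induced) by the vertices $y\in S(x)$ with $f(y)<f(x)$, and $i_f(x)=1-\chi(S^-(x))$. Probability space: $\Omega\subset[-1,1]^n$ is the set of all injective functions on $V$ with values in $[-1,1]$, and $\mathrm{P}$ is the product Lebesgue measure normalized so that $\mathrm{P}[\{f: f(v)\in[a,b]\}]=(b-a)/2$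 for $-1\le a<b\le 1$ and each $v\in V$, with the random variables $f\mapsto f(v)$, $v\in V$, independent and identically distributed. (The non-injective functions form a null set, so $\Omega$ has full measure.) $\mathrm{E}$ denotes expectation with respect to $\mathrm{P}$. *)

theory Defs
  imports "HOL-Probability.Probability" "Graph_Theory.Digraph_Component"
begin

text \<open>
  The locale \<^locale>\<open>graph\<close> describes finite, symmetric, loop-free digraphs without parallel arcs,
  that is, finite simple graphs: an undirected edge is a pair of opposite arcs, and adjacency of
  \<open>u\<close> and \<open>v\<close> is \<open>u \<rightarrow>\<^bsub>G\<^esub> v\<close>.
\<close>

definition cliques :: "('a, 'b) pre_digraph \<Rightarrow> nat \<Rightarrow> 'a set set" where
  "cliques H m = {C. C \<subseteq> verts H \<and> finite C \<and> card C = m \<and>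
      (\<forall>u\<in>C. \<forall>v\<in>C. u \<noteq> v \<longrightarrow> u \<rightarrow>\<^bsub>H\<^esub> v)}"

definition clique_count :: "('a, 'b) pre_digraph \<Rightarrow> nat \<Rightarrow> nat" where
  "clique_count H k = card (cliques H (k + 1))"

text \<open>For a finite graph, all but finitely many terms of the two series below vanish.\<close>

definition euler_char :: "('a, 'b) pre_digraph \<Rightarrow> real" where
  "euler_char H = (\<Sum>k. (-1) ^ k * real (clique_count H k))"

definition unit_sphere :: "('a, 'b) pre_digraph \<Rightarrow> 'a \<Rightarrow> ('a, 'b) pre_digraph" where
  "unit_sphere G x = G \<restriction> {y \<in> verts G. x \<rightarrow>\<^bsub>G\<^esub> y}"

text \<open>The case distinction is the convention that the count with index \<open>-1\<close> equals \<open>1\<close>.\<close>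

definition curvature :: "('a, 'b) pre_digraph \<Rightarrow> 'a \<Rightarrow> real" where
  "curvature G x = (\<Sum>k. (-1) ^ k *
      (case k of 0 \<Rightarrow> 1 | Suc j \<Rightarrow> real (clique_count (unit_sphere G x) j)) / real (k + 1))"

definition exit_set :: "('a, 'b) pre_digraph \<Rightarrow> ('a \<Rightarrow> real) \<Rightarrow> 'a \<Rightarrow> ('a, 'b) pre_digraph" where
  "exit_set G f x = unit_sphere G x \<restriction> {y \<in> verts (unit_sphere G x). f y < f x}"

definition index :: "('a, 'b) pre_digraph \<Rightarrow> ('a \<Rightarrow> real) \<Rightarrow> 'a \<Rightarrow> real" where
  "index G f x = 1 - euler_char (exit_set G f x)"

text \<open>
  Functions on a vertex set \<open>V\<close> are total functions that are \<^const>\<open>undefined\<close> outside \<open>V\<close>, as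
  in the finite product measure.
\<close>

definition injective_functions :: "'a set \<Rightarrow> ('a \<Rightarrow> real) set" where
  "injective_functions V = {f \<in> V \<rightarrow>\<^sub>E {-1..1}. inj_on f V}"

definition function_space :: "'a set \<Rightarrow> ('a \<Rightarrow> real) measure" where
  "function_space V =
     restrict_space (\<Pi>\<^sub>M v\<in>V. uniform_measure lborel {-1..1}) (injective_functions V)"

text \<open>In particular, the injective functions have full measure in the product.\<close>

lemma prob_space_function_space:
  fixes V :: "'a set"
  assumes "finite V"
  shows "prob_space (function_space V)"
proof -
  define U where "U = uniform_measure lborel {-1..1::real}"
  define M where "M = (\<Pi>\<^sub>M v\<in>V. U)"
  have sU[measurable_cong]: "sets U = sets borel" by (simp add: U_def)
  interpret U: prob_space U unfolding U_def by (rule prob_space_uniform_measure) auto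
  interpret product_prob_space "\<lambda>_. U" V by unfold_locales
  interpret Q: prob_space M unfolding M_def by (rule prob_space_PiM) unfold_locales
  have null: "U.prob {a} = 0" for a
    unfolding U_def by (subst measure_uniform_measure) (auto simp: measure_def emeasure_lborel_countable)
  have comp: "(\<lambda>f. f w) \<in> borel_measurable M" if "w \<in> V" for w
    unfolding M_def using that by (subst measurable_cong_sets[OF refl sU[symmetric]]) auto
  have neq_sets: "{f \<in> space M. f u \<noteq> f v} \<in> sets M" if "u \<in> V" "v \<in> V" for u v
    by (rule borel_measurable_neq[OF comp[OF that(1)] comp[OF that(2)]])
  have range_sets: "{f \<in> space M. f u \<in> {-1..1}} \<in> sets M" if "u \<in> V" for u
    using measurable_sets[OF comp[OF that], of "{-1..1}"]
    by (simp add: vimage_def Int_def conj_commute)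
  have distinct: "AE f in M. f u \<noteq> f v" if uv: "u \<in> V" "v \<in> V" "u \<noteq> v" for u v
  proof -
    let ?N = "\<Pi>\<^sub>M w\<in>V - {v}. U"
    interpret N: prob_space ?N by (rule prob_space_PiM) unfold_locales
    interpret UN: pair_sigma_finite U ?N by unfold_locales
    have [measurable]: "(\<lambda>X. X u) \<in> borel_measurable ?N"
      using uv by (subst measurable_cong_sets[OF refl sU[symmetric]]) auto
    have "AE X in ?N. X u \<noteq> a" for a
    proof (rule AE_PiM_component)
      show "AE b in U. b \<noteq> a"
        by (rule AE_I[where N="{a}"]) (auto simp: null U.emeasure_eq_measure sU)
    qed (use uv U.prob_space_axioms in auto)
    then have AE: "AE p in U \<Otimes>\<^sub>M ?N. snd p u \<noteq> fst p"
      by (intro UN.AE_pair_measure) auto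
    have M: "distr (U \<Otimes>\<^sub>M ?N) M (\<lambda>(x, X). X(v := x)) = M"
      using distr_pair_PiM_eq_PiM[of "V - {v}" "\<lambda>_. U" v] U.prob_space_axioms uv
      by (simp add: M_def insert_absorb)
    have meas: "(\<lambda>(x, X). X(v := x)) \<in> measurable (U \<Otimes>\<^sub>M ?N) M"
      unfolding M_def using measurable_fun_upd[of V "V - {v}" v snd "U \<Otimes>\<^sub>M ?N" "\<lambda>_. U" fst] uv
      by (auto simp: case_prod_beta')
    have "AE f in distr (U \<Otimes>\<^sub>M ?N) M (\<lambda>(x, X). X(v := x)). f u \<noteq> f v"
      by (subst AE_distr_iff[OF meas])
         (use AE uv neq_sets in \<open>auto simp: case_prod_beta'\<close>)
    then show ?thesis by (simp only: M)
  qed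
  have range: "AE f in M. f u \<in> {-1..1}" if u: "u \<in> V" for u
    unfolding M_def
  proof (rule AE_PiM_component)
    show "AE a in U. a \<in> {-1..1}" unfolding U_def by (rule AE_uniform_measureI) auto
  qed (use u U.prob_space_axioms in auto)
  have "AE f in M. \<forall>u\<in>V. f u \<in> {-1..1}"
    by (rule AE_finite_allI[OF assms range])
  moreover have "AE f in M. \<forall>u\<in>V. \<forall>v\<in>V. u \<noteq> v \<longrightarrow> f u \<noteq> f v"
    by (intro AE_finite_allI[OF assms]) (use distinct in auto)
  ultimately have AE: "AE f in M. f \<in> injective_functions V"
    using AE_space
    by eventually_elim
       (auto simp: injective_functions_def inj_on_def M_def space_PiM PiE_def Pi_def)
  have eq: "injective_functions V = {f \<in> space M. (\<forall>u\<in>V. f u \<in> {-1..1}) \<and>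
      (\<forall>u\<in>V. \<forall>v\<in>V. u \<noteq> v \<longrightarrow> f u \<noteq> f v)}"
    by (auto simp: injective_functions_def inj_on_def M_def U_def space_PiM PiE_def Pi_def)
  have meas: "injective_functions V \<in> sets M"
    unfolding eq using assms
    by (intro sets.sets_Collect_conj sets.sets_Collect_finite_All sets.sets_Collect_imp sets.sets_Collect_const)
       (use range_sets neq_sets in auto)
  then have "Q.prob (injective_functions V) = 1"
    using AE Q.prob_eq_1 by blast
  then show ?thesis
    using meas sets.sets_into_space[OF meas] unfolding function_space_def U_def[symmetric] M_def[symmetric]
    by (intro prob_spaceI)
       (simp add: emeasure_restrict_space space_restrict_space Q.emeasure_eq_measure Int_absorb2)
qed

end

theory Submission
  imports Defs
begin

text \<open>
  The index depends on \<open>f\<close> only through the exit set, and the \<open>K\<^bsub>k+1\<^esub>\<close> subgraphs of the exit set are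
  those \<open>K\<^bsub>k+1\<^esub>\<close> subgraphs \<open>C\<close> of the unit sphere on which \<open>f\<close> stays below \<open>f x\<close>. So the index is
  one minus an alternating sum of indicators of the events ``\<open>f y < f x\<close> for all \<open>y \<in> C\<close>'', indexed
  by the cliques \<open>C\<close> of the sphere, which do not depend on \<open>f\<close> (\<open>index_eq_clique_sum\<close>). By linearity
  only the probability of each such event is needed.

  The event says that \<open>x\<close> carries the largest value of \<open>f\<close> on \<open>insert x C\<close>, a set of \<open>k + 2\<close>
  vertices because \<open>x\<close> is not in its own sphere. The values are independent and identically
  distributed, so each of these vertices is equally likely to carry the largest value, and by
  injectivity exactly one of them does: the probability is \<open>1 / (k + 2)\<close> (\<open>prob_max_at\<close>). The
  expectation is therefore \<open>1\<close> minus the alternating sum of \<open>V\<^sub>k(x) / (k + 2)\<close>, and this is the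
  curvature series with its leading term \<open>1\<close> split off and the remaining terms shifted by one
  (\<open>curvature_finite_sum\<close>).
\<close>

section \<open>Symmetry of random injective functions\<close>

lemma PiM_component_borel_measurable:
  assumes "v \<in> V"
  shows "(\<lambda>f. f v) \<in> borel_measurable (\<Pi>\<^sub>M v\<in>V. uniform_measure lborel {-1..1::real})"
  using measurable_component_singleton[OF assms, of "\<lambda>_. uniform_measure lborel {-1..1::real}"]
  by (simp cong: measurable_cong_sets)

lemma component_measurable:
  assumes "v \<in> V"
  shows "(\<lambda>f. f v) \<in> borel_measurable (function_space V)"
  unfolding function_space_def
  by (intro measurable_restrict_space1 PiM_component_borel_measurable assms)

lemma space_function_space: "space (function_space V) = injective_functions V"
  by (auto simp: function_space_def space_restrict_space space_PiM injective_functions_def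
      PiE_def Pi_def)

lemma injective_functions_measurable:
  assumes "finite V"
  shows "injective_functions V \<in> sets (\<Pi>\<^sub>M v\<in>V. uniform_measure lborel {-1..1::real})"
proof -
  let ?M = "\<Pi>\<^sub>M v\<in>V. uniform_measure lborel {-1..1::real}"
  have comp: "(\<lambda>f. f v) \<in> borel_measurable ?M" if "v \<in> V" for v
    using that by (rule PiM_component_borel_measurable)
  have "injective_functions V = {f \<in> space ?M. (\<forall>u\<in>V. -1 \<le> f u \<and> f u \<le> 1) \<and>
      (\<forall>u\<in>V. \<forall>v\<in>V. u \<noteq> v \<longrightarrow> f u \<noteq> f v)}"
    by (auto simp: injective_functions_def inj_on_def space_PiM PiE_def Pi_def)
  also have "\<dots> \<in> sets ?M"
    using assms comp
    by (intro sets.sets_Collect_conj sets.sets_Collect_finite_All sets.sets_Collect_imp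
        sets.sets_Collect_const borel_measurable_le borel_measurable_neq) auto
  finally show ?thesis .
qed

lemma max_event_measurable:
  assumes "finite V" "A \<subseteq> V" "x \<in> V"
  shows "{f \<in> space (function_space V). \<forall>y\<in>A. f y < f x} \<in> sets (function_space V)"
  using assms
  by (intro sets.sets_Collect_finite_All borel_measurable_less component_measurable)
     (auto intro: finite_subset)

text \<open>
  Reindexing by a bijection preserves a product of identical factors. It also maps the injective
  functions onto themselves, so it preserves the restriction to them.
\<close>

lemma measure_function_space_reindex:
  assumes fin: "finite V" and p: "bij_betw p V V" and E: "E \<in> sets (function_space V)"
  shows "measure (function_space V) {f \<in> space (function_space V). (\<lambda>v\<in>V. f (p v)) \<in> E}
       = measure (function_space V) E"
proof -
  let ?U = "uniform_measure lborel {-1..1::real}"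
  let ?M = "\<Pi>\<^sub>M v\<in>V. ?U"
  let ?I = "injective_functions V"
  let ?T = "\<lambda>f::'a \<Rightarrow> real. \<lambda>v\<in>V. f (p v)"
  have pV: "p \<in> V \<rightarrow> V" and inj: "inj_on p V" and surj: "p ` V = V"
    using p by (auto simp: bij_betw_def)
  have I: "?I \<in> sets ?M" by (rule injective_functions_measurable[OF fin])
  have distr: "distr ?M ?M ?T = ?M"
    using distr_PiM_reindex[of V "\<lambda>_. ?U" p V] inj pV
    by (simp add: prob_space_uniform_measure)
  have T: "?T \<in> measurable ?M ?M"
    using pV by (intro measurable_restrict measurable_component_singleton) auto
  have EI: "E \<subseteq> ?I" "E \<in> sets ?M"
    using E I sets.sets_into_space[OF I]
    by (auto simp: function_space_def sets_restrict_space_iff Int_absorb2)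
  \<comment> \<open>Injectivity on \<open>V\<close> and the bounds on the values are not affected by permuting \<open>V\<close>.\<close>
  have inv: "f \<in> ?I" if f: "f \<in> space ?M" and Tf: "?T f \<in> ?I" for f
  proof -
    have "f (p v) \<in> {-1..1}" if "v \<in> V" for v
      using Tf that by (auto simp: injective_functions_def dest!: PiE_mem)
    then have "f v \<in> {-1..1}" if "v \<in> V" for v
      using that surj by force
    moreover have "inj_on (f \<circ> p) V"
      using Tf by (auto simp: injective_functions_def inj_on_def)
    then have "inj_on f V"
      using inj_on_imageI surj by metis
    ultimately show ?thesis
      using f by (auto simp: injective_functions_def space_PiM PiE_def Pi_def)
  qed
  have eq: "{f \<in> space (function_space V). ?T f \<in> E} = ?T -` E \<inter> space ?M"
    using EI(1) inv sets.sets_into_space[OF I] by (auto simp: space_function_space)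
  have "measure (function_space V) {f \<in> space (function_space V). ?T f \<in> E}
      = measure ?M {f \<in> space (function_space V). ?T f \<in> E}"
    unfolding function_space_def using I sets.sets_into_space[OF I]
    by (intro measure_restrict_space) (auto simp: space_restrict_space Int_absorb2)
  also have "\<dots> = measure (distr ?M ?M ?T) E"
    unfolding eq using T EI(2) by (simp add: measure_distr)
  also have "\<dots> = measure (function_space V) E"
    unfolding distr unfolding function_space_def using I EI sets.sets_into_space[OF I]
    by (intro measure_restrict_space[symmetric]) (auto simp: Int_absorb2)
  finally show ?thesis .
qed

text \<open>
  For \<open>w \<in> A\<close> consider the event that \<open>f\<close> attains its strict maximum over \<open>A\<close> at \<open>w\<close>. The
  transposition of \<open>w\<close> and \<open>x\<close> carries the event for \<open>w\<close> to the event for \<open>x\<close>, so all of them have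
  the same probability. They partition the space of injective functions, so this probability is
  one over their number.
\<close>

lemma prob_max_at:
  assumes fin: "finite V" and A: "A \<subseteq> V" and x: "x \<in> A"
  shows "measure (function_space V) {f \<in> space (function_space V). \<forall>y\<in>A - {x}. f y < f x}
       = 1 / card A"
proof -
  let ?F = "function_space V"
  let ?E = "\<lambda>w. {f \<in> space ?F. \<forall>y\<in>A - {w}. f y < f w}"
  interpret F: prob_space ?F by (rule prob_space_function_space[OF fin])
  have finA: "finite A" using fin A by (rule rev_finite_subset)
  have E: "?E w \<in> sets ?F" if "w \<in> A" for w
    using that A fin by (intro max_event_measurable) auto
  have same: "F.prob (?E w) = F.prob (?E x)" if w: "w \<in> A" for w
  proof -
    let ?t = "Transposition.transpose w x"
    have bij: "bij_betw ?t V V"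
      using w x A by (subst Transposition.bij_betw_transpose_iff) auto
    have tV: "?t y \<in> V" if "y \<in> V" for y
      using bij that by (auto simp: bij_betw_def)
    have inI: "(\<lambda>v\<in>V. f (?t v)) \<in> injective_functions V" if f: "f \<in> injective_functions V" for f
    proof -
      have "inj_on (f \<circ> ?t) V"
        using f bij by (intro comp_inj_on) (auto simp: injective_functions_def bij_betw_def)
      then have "inj_on (\<lambda>v\<in>V. f (?t v)) V"
        by (auto simp: inj_on_def)
      then show ?thesis
        using f tV by (auto simp: injective_functions_def PiE_def Pi_def)
    qed
    have all: "(\<forall>y\<in>A - {x}. f (?t y) < f (?t x)) \<longleftrightarrow> (\<forall>y\<in>A - {w}. f y < f w)" for f :: "'a \<Rightarrow> real"
    proof -
      have "?t ` (A - {x}) = A - {w}"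
        using w x by (auto simp: Transposition.transpose_def image_iff split: if_splits)
      then have "(\<forall>y\<in>A - {w}. f y < f w) \<longleftrightarrow> (\<forall>y\<in>?t ` (A - {x}). f y < f w)" by simp
      then show ?thesis by simp
    qed
    have "?E w = {f \<in> space ?F. (\<lambda>v\<in>V. f (?t v)) \<in> ?E x}"
    proof (intro Collect_cong conj_cong refl)
      fix f assume f: "f \<in> space ?F"
      have "(\<lambda>v\<in>V. f (?t v)) \<in> ?E x \<longleftrightarrow>
          (\<forall>y\<in>A - {x}. (\<lambda>v\<in>V. f (?t v)) y < (\<lambda>v\<in>V. f (?t v)) x)"
        using inI f by (simp add: space_function_space)
      also have "\<dots> \<longleftrightarrow> (\<forall>y\<in>A - {x}. f (?t y) < f (?t x))"
        using x A by (intro ball_cong refl) (auto simp: subset_iff)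
      finally show "(\<forall>y\<in>A - {w}. f y < f w) \<longleftrightarrow> (\<lambda>v\<in>V. f (?t v)) \<in> ?E x"
        using all[of f] by blast
    qed
    then show ?thesis
      using measure_function_space_reindex[OF fin bij E[OF x]] by simp
  qed
  have cover: "(\<Union>w\<in>A. ?E w) = space ?F"
  proof (intro equalityI subsetI)
    fix f assume f: "f \<in> space ?F"
    have "Max (f ` A) \<in> f ` A" using finA x by (intro Max_in) auto
    then obtain w where w: "w \<in> A" "f w = Max (f ` A)" by auto
    have "f y < f w" if "y \<in> A - {w}" for y
    proof -
      have "f y \<le> f w" using that w finA by simp
      moreover have "inj_on f V"
        using f by (simp add: space_function_space injective_functions_def)
      then have "f y \<noteq> f w"
        using that w(1) A by (auto dest: inj_onD)
      ultimately show ?thesis by simp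
    qed
    then show "f \<in> (\<Union>w\<in>A. ?E w)" using f w(1) by auto
  qed auto
  have disj: "disjoint_family_on ?E A"
    by (auto simp: disjoint_family_on_def) (metis DiffI less_asym singletonD)
  have "1 = F.prob (\<Union>w\<in>A. ?E w)"
    unfolding cover by (simp add: F.prob_space)
  also have "\<dots> = (\<Sum>w\<in>A. F.prob (?E w))"
    using finA E disj by (intro F.finite_measure_finite_Union) auto
  also have "\<dots> = card A * F.prob (?E x)"
    using same by simp
  finally have "card A * F.prob (?E x) = 1" by simp
  moreover have "card A \<noteq> 0" using finA x by auto
  ultimately show ?thesis by (simp add: eq_divide_eq mult.commute)
qed

section \<open>Cliques and Euler characteristic\<close>

lemma arcs_ends_induce_subgraph:
  "u \<rightarrow>\<^bsub>G \<restriction> W\<^esub> v \<longleftrightarrow> u \<rightarrow>\<^bsub>G\<^esub> v \<and> u \<in> W \<and> v \<in> W"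
  by (auto simp: arcs_ends_def arc_to_ends_def)

text \<open>
  This separates the two sources of variation: the cliques of the sphere are fixed by the graph,
  and the randomness of \<open>f\<close> only selects among them.
\<close>

lemma cliques_exit_set:
  "cliques (exit_set G f x) m = {C \<in> cliques (unit_sphere G x) m. \<forall>y\<in>C. f y < f x}"
  unfolding cliques_def exit_set_def arcs_ends_induce_subgraph by fastforce

lemma finite_cliques: "finite (verts H) \<Longrightarrow> finite (cliques H m)"
  by (rule finite_subset[of _ "Pow (verts H)"]) (auto simp: cliques_def)

lemma clique_count_eq_0:
  assumes "finite (verts H)" "card (verts H) \<le> k"
  shows "clique_count H k = 0"
proof -
  have "card C \<noteq> k + 1" if "C \<subseteq> verts H" for C
    using card_mono[OF assms(1) that] assms(2) by simp
  then have "cliques H (k + 1) = {}" by (auto simp: cliques_def)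
  then show ?thesis by (simp add: clique_count_def)
qed

lemma euler_char_finite_sum:
  assumes "finite (verts H)" "card (verts H) \<le> N"
  shows "euler_char H = (\<Sum>k<N. (-1) ^ k * real (clique_count H k))"
  unfolding euler_char_def using assms
  by (intro suminf_finite) (auto simp: clique_count_eq_0)

text \<open>
  The index shift \<open>k = j + 1\<close> turns the sign \<open>(-1)\<^sup>k\<close> into \<open>- (-1)\<^sup>j\<close> and the denominator \<open>k + 1\<close> into
  \<open>j + 2\<close>, the size of a clique of the sphere counted by \<open>V\<^sub>j\<close> together with its centre. This is
  the form in which the expectation of the index appears.
\<close>

lemma curvature_finite_sum:
  assumes "finite (verts (unit_sphere G x))" "card (verts (unit_sphere G x)) \<le> N"
  shows "curvature G x =
    1 - (\<Sum>k<N. (-1) ^ k * (real (clique_count (unit_sphere G x) k) / real (k + 2)))"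
proof -
  let ?g = "\<lambda>k. (-1) ^ k *
      (case k of 0 \<Rightarrow> 1 | Suc j \<Rightarrow> real (clique_count (unit_sphere G x) j)) / real (k + 1)"
  have "?g k = 0" if "k \<notin> {..<Suc N}" for k
    using that assms by (cases k) (auto simp: clique_count_eq_0)
  then have "curvature G x = (\<Sum>k<Suc N. ?g k)"
    unfolding curvature_def by (intro suminf_finite) auto
  also have "\<dots> = ?g 0 + (\<Sum>k<N. ?g (Suc k))" by (rule sum.lessThan_Suc_shift)
  also have "(\<Sum>k<N. ?g (Suc k)) =
      - (\<Sum>k<N. (-1) ^ k * (real (clique_count (unit_sphere G x) k) / real (k + 2)))"
    unfolding sum_negf[symmetric] by (intro sum.cong refl) simp
  finally show ?thesis by simp
qed

text \<open>
  The bound \<open>N\<close> on the summation range depends on the sphere and not on \<open>f\<close>, which makes the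
  right-hand side a fixed finite linear combination of indicators.
\<close>

lemma index_eq_clique_sum:
  assumes fin: "finite (verts (unit_sphere G x))" and N: "card (verts (unit_sphere G x)) \<le> N"
  shows "index G f x = 1 - (\<Sum>k<N. (-1) ^ k *
    (\<Sum>C\<in>cliques (unit_sphere G x) (k + 1). indicator {f. \<forall>y\<in>C. f y < f x} f))"
proof -
  have sub: "verts (exit_set G f x) \<subseteq> verts (unit_sphere G x)"
    by (auto simp: exit_set_def)
  have "real (clique_count (exit_set G f x) k) =
      (\<Sum>C\<in>cliques (unit_sphere G x) (k + 1). indicator {f. \<forall>y\<in>C. f y < f x} f)" for k
    using finite_cliques[OF fin]
    by (simp add: clique_count_def cliques_exit_set indicator_def sum.If_cases Int_def)
  moreover have "card (verts (exit_set G f x)) \<le> N"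
    using card_mono[OF fin sub] N by simp
  ultimately show ?thesis
    unfolding index_def using euler_char_finite_sum[OF finite_subset[OF sub fin]] by simp
qed

section \<open>The expectation of the index\<close>

theorem theorem3:
  fixes G :: "('a, 'b) pre_digraph" and x :: 'a
  assumes "graph G" and "x \<in> verts G"
  shows "integrable (function_space (verts G)) (\<lambda>f. index G f x) \<and>
         (LINT f|function_space (verts G). index G f x) = curvature G x"
proof -
  interpret graph G by fact
  let ?F = "function_space (verts G)"
  let ?S = "unit_sphere G x"
  define N where "N = card (verts ?S)"
  define X :: "'a set \<Rightarrow> ('a \<Rightarrow> real) \<Rightarrow> real"
    where "X C = indicator {f. \<forall>y\<in>C. f y < f x}" for C
  interpret F: prob_space ?F by (rule prob_space_function_space) simp
  have S: "verts ?S \<subseteq> verts G - {x}"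
    by (auto simp: unit_sphere_def dest: adj_not_same)
  then have finS: "finite (verts ?S)" by (rule finite_subset) simp
  have index: "index G f x = 1 - (\<Sum>k<N. (-1) ^ k * (\<Sum>C\<in>cliques ?S (k + 1). X C f))" for f
    unfolding X_def using finS by (intro index_eq_clique_sum) (auto simp: N_def)
  have X: "has_bochner_integral ?F (X C) (1 / real (k + 2))" if C: "C \<in> cliques ?S (k + 1)" for C k
  proof -
    let ?E = "{f \<in> space ?F. \<forall>y\<in>C. f y < f x}"
    have CV: "C \<subseteq> verts G" "x \<notin> C" "finite C" "card C = k + 1"
      using C S by (auto simp: cliques_def)
    have "F.prob ?E = 1 / real (k + 2)"
      using prob_max_at[of "verts G" "insert x C" x] CV assms(2) by simp
    moreover have "?E \<in> sets ?F"
      using CV assms(2) by (intro max_event_measurable) auto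
    ultimately have "has_bochner_integral ?F (indicator ?E) (1 / real (k + 2))"
      using has_bochner_integral_real_indicator[of ?E ?F] by (simp add: F.emeasure_eq_measure)
    then show ?thesis
      by (rule has_bochner_integral_cong[THEN iffD1, rotated -1])
         (auto simp: X_def indicator_def)
  qed
  have "has_bochner_integral ?F (\<lambda>f. index G f x)
      (1 - (\<Sum>k<N. (-1) ^ k * (\<Sum>C\<in>cliques ?S (k + 1). 1 / real (k + 2))))"
    unfolding index
    by (intro has_bochner_integral_diff has_bochner_integral_sum has_bochner_integral_mult_right X)
       (auto simp: has_bochner_integral_iff F.prob_space)
  also have "1 - (\<Sum>k<N. (-1) ^ k * (\<Sum>C\<in>cliques ?S (k + 1). 1 / real (k + 2))) = curvature G x"
    using curvature_finite_sum[OF finS, of N] by (simp add: N_def clique_count_def)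
  finally show ?thesis by (simp add: has_bochner_integral_iff)
qed

end
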